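(* If $0\le\lambda<2$, then $\mathcal{T}_{\mathbb{R}}(\Omega_\lambda)=1+\lambda$.
   Context: For $\lambda\ge 0$ let $\Omega_\lambda=(-1,1)\cup(\lambda-1,\lambda+1)\cup(-\lambda-1,-\lambda+1)\subset\mathbb{R}$. A function $f:\mathbb{R}\to\mathbb{C}$ is positive definite if $\sum_{j,k=1}^m z_j\overline{z_k}f(x_j-x_k)\ge 0$ for all finite choices of $x_1,\dots,x_m\in\mathbb{R}$ and $z_1,\dots,z_m\in\mathbb{C}$. For an open bounded set $\Omega\subset\mathbb{R}$ with $\Omega=-\Omega$ and $0\in\Omega$, the Turán constant is $$\mathcal{T}_{\mathbb{R}}(\Omega)=\sup\left\{\int_{\mathbb{R}}f(x)\,dx: f\in C(\mathbb{R}),\ f \text{ positive definite},\ f(0)=1,\ \operatorname{supp} f\subset\Omega\right\},$$ where $\operatorname{supp} f$ is the closed support of $f$ (the integrals in question are automatically real). *)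

theory Defs
  imports "HOL-Analysis.Analysis"
begin

text \<open>Membership in \<open>\<real>\<^sub>\<ge>\<^sub>0\<close> says that the complex sum is real and nonnegative.\<close>

definition positive_definite :: "(real \<Rightarrow> complex) \<Rightarrow> bool" where
  "positive_definite f \<longleftrightarrow>
     (\<forall>(m::nat) (x :: nat \<Rightarrow> real) (z :: nat \<Rightarrow> complex).
        (\<Sum>j<m. \<Sum>k<m. z j * cnj (z k) * f (x j - x k)) \<in> \<real>\<^sub>\<ge>\<^sub>0)"

definition closed_support :: "(real \<Rightarrow> complex) \<Rightarrow> real set" where
  "closed_support f = closure {x. f x \<noteq> 0}"

definition turan_admissible :: "real set \<Rightarrow> (real \<Rightarrow> complex) \<Rightarrow> bool" where
  "turan_admissible \<Omega> f \<longleftrightarrow>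
     continuous_on UNIV f \<and> positive_definite f \<and> f 0 = 1 \<and> closed_support f \<subseteq> \<Omega>"

text \<open>
  Meant for open bounded \<open>\<Omega>\<close> with \<open>\<Omega> = - \<Omega>\<close> and \<open>0 \<in> \<Omega>\<close>. An admissible \<open>f\<close> satisfies
  \<open>f (- x) = cnj (f x)\<close>, so its integral is real and \<open>Re\<close> only changes the type.
  The supremum is taken in \<^typ>\<open>ereal\<close>, where it is a least upper bound unconditionally.
\<close>

definition turan_constant :: "real set \<Rightarrow> ereal" where
  "turan_constant \<Omega> = (SUP f \<in> {f. turan_admissible \<Omega> f}. ereal (Re (\<integral>x. f x \<partial>lborel)))"

definition Omega :: "real \<Rightarrow> real set" where
  "Omega l = {-1<..<1} \<union> {l - 1<..<l + 1} \<union> {- l - 1<..<- l + 1}"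

end

theory Submission
  imports Defs
begin

text \<open>
  For \<open>0 \<le> l < 2\<close> the three intervals overlap and \<open>Omega l\<close> is the single interval \<open>(-a, a)\<close>
  with \<open>a = 1 + l\<close>, so the claim is the classical fact that the Turan constant of \<open>(-a, a)\<close>
  is \<open>a\<close>.

  For the upper bound, the idea is that the periodization \<open>F t = (\<Sum>k\<in>\<int>. f (t + k * a))\<close> of an
  admissible \<open>f\<close> is again positive definite with \<open>F 0 = f 0 = 1\<close>, because \<open>f\<close> vanishes outside
  \<open>(-a, a)\<close>. Hence \<open>\<bar>F\<bar> \<le> 1\<close>, and integrating over one period gives \<open>(\<integral>x. f x) \<le> a\<close>.
  For \<open>0 < t < a\<close> only \<open>f t\<close> and \<open>f (t - a)\<close> occur in \<open>F t\<close>. The bound on \<open>F\<close> is obtained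
  without limits of functions (lemma \<open>positive_definite_periodization_le\<close>): weight \<open>1\<close> is put on
  \<open>n\<close> consecutive multiples of \<open>a\<close> and weight \<open>-1\<close> on their translates by \<open>t\<close>, and \<open>n\<close> is large.
  The cross terms of this quadratic form contain \<open>F t\<close> and \<open>F (- t)\<close>, so what comes out is
  \<open>Re (F t + F (- t)) \<le> 2\<close>.

  For the lower bound, the triangle function of half-width \<open>b\<close> is the normalized autocorrelation
  of the indicator of an interval of length \<open>b\<close>, hence positive definite
  (lemma \<open>positive_definite_triangle\<close>). It has integral \<open>b\<close> and is admissible
  for every \<open>0 < b < a\<close>. For \<open>b = a\<close> its closed support is \<open>[-a, a]\<close>, so the value \<open>a\<close> is only
  approached within this family.
\<close>

section \<open>Positive definite sums over finite index sets\<close>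

lemma positive_definite_sum_nonneg:
  fixes x :: "'i \<Rightarrow> real" and z :: "'i \<Rightarrow> complex"
  assumes "positive_definite f" and "finite A"
  shows "(\<Sum>i\<in>A. \<Sum>j\<in>A. z i * cnj (z j) * f (x i - x j)) \<in> \<real>\<^sub>\<ge>\<^sub>0"
proof -
  obtain e where e: "bij_betw e {..<card A} A"
    using \<open>finite A\<close> bij_betw_from_nat_into_finite by blast
  have "(\<Sum>i\<in>A. \<Sum>j\<in>A. z i * cnj (z j) * f (x i - x j)) =
        (\<Sum>p<card A. \<Sum>q<card A. z (e p) * cnj (z (e q)) * f (x (e p) - x (e q)))"
    by (simp add: sum.reindex_bij_betw[OF e, symmetric])
  also have "\<dots> \<in> \<real>\<^sub>\<ge>\<^sub>0"
    using assms(1) unfolding positive_definite_def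
    by (elim allE[of _ "card A"] allE[of _ "\<lambda>p. x (e p)"] allE[of _ "\<lambda>p. z (e p)"])
  finally show ?thesis .
qed

section \<open>The upper bound\<close>

text \<open>
  An argument \<open>(j - k) * a + t\<close> with \<open>0 < t < a\<close> lies in \<open>(-a, a)\<close> only for \<open>k = j\<close> and
  \<open>k = j + 1\<close>; the latter pair is missing for the last \<open>j\<close>.
\<close>

lemma sum_lattice_differences:
  fixes g :: "real \<Rightarrow> 'b::real_algebra_1"
  assumes zero: "\<And>x. a \<le> \<bar>x\<bar> \<Longrightarrow> g x = 0" and t: "0 < t" "t < a"
  shows "(\<Sum>j<Suc n. \<Sum>k<Suc n. g ((real j - real k) * a + t))
         = of_nat (Suc n) * g t + of_nat n * g (t - a)"
proof -
  have split: "g ((real j - real k) * a + t)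
      = (if k = j then g t else 0) + (if k = Suc j then g (t - a) else 0)" for j k :: nat
  proof -
    consider "k = j" | "k = Suc j" | "k < j" | "Suc j < k" by linarith
    then show ?thesis
    proof cases
      case 3
      then have "1 \<le> real j - real k" by linarith
      then have "1 * a \<le> (real j - real k) * a" using t by (intro mult_right_mono) auto
      then have "a \<le> \<bar>(real j - real k) * a + t\<bar>" using t by linarith
      with 3 show ?thesis by (simp add: zero)
    next
      case 4
      then have "real j - real k \<le> - 2" by linarith
      then have "(real j - real k) * a \<le> - 2 * a" using t by (intro mult_right_mono) auto
      then have "a \<le> \<bar>(real j - real k) * a + t\<bar>" using t by linarith
      with 4 show ?thesis by (simp add: zero)
    qed (auto simp: algebra_simps)
  qed
  have "(\<Sum>j<Suc n. \<Sum>k<Suc n. g ((real j - real k) * a + t))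
      = (\<Sum>j<Suc n. g t) + (\<Sum>j<Suc n. if j < n then g (t - a) else 0)"
    unfolding split sum.distrib by (simp del: sum.lessThan_Suc)
  then show ?thesis by simp
qed

text \<open>
  The quadratic form with weight \<open>1\<close> at \<open>j * a\<close> and \<open>-1\<close> at \<open>j * a + t\<close>, for \<open>j = 0, \<dots>, n\<close>, is
  \<open>2 * (n + 1)\<close> times \<open>f 0\<close> minus the cross terms. Division by \<open>n\<close> leaves the claimed bound in the
  limit, since the boundary effect is a single term.
\<close>

lemma positive_definite_periodization_le:
  assumes pd: "positive_definite f" and f0: "f 0 = 1"
    and zero: "\<And>x. a \<le> \<bar>x\<bar> \<Longrightarrow> f x = 0" and t: "0 < t" "t < a"
  shows "Re (f t) + Re (f (- t)) + Re (f (t - a)) + Re (f (a - t)) \<le> 2"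
proof -
  define S where "S = Re (f t) + Re (f (- t)) + Re (f (t - a)) + Re (f (a - t)) - 2"
  define R where "R = 2 - Re (f t) - Re (f (- t))"
  have bound: "real n * S \<le> R" for n
  proof -
    define x where "x = (\<lambda>(j, s). real j * a + (if s then t else 0))"
    define z :: "nat \<times> bool \<Rightarrow> complex" where "z = (\<lambda>(j, s). if s then - 1 else 1)"
    define A where "A = {..<Suc n} \<times> (UNIV :: bool set)"
    have diag: "(\<Sum>j<Suc n. \<Sum>k<Suc n. f ((real j - real k) * a)) = of_nat (Suc n)"
    proof -
      have "f ((real j - real k) * a) = (if k = j then 1 else 0)" for j k :: nat
      proof (cases "k = j")
        case False
        then have "1 \<le> \<bar>real j - real k\<bar>" by linarith
        then have "1 * a \<le> \<bar>real j - real k\<bar> * a" using t by (intro mult_right_mono) auto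
        then have "a \<le> \<bar>(real j - real k) * a\<bar>" using t by (simp add: abs_mult)
        with False show ?thesis by (simp add: zero)
      qed (simp add: f0)
      then show ?thesis by simp
    qed
    have plus: "(\<Sum>j<Suc n. \<Sum>k<Suc n. f ((real j - real k) * a + t))
        = of_nat (Suc n) * f t + of_nat n * f (t - a)"
      using zero t by (rule sum_lattice_differences)
    have "(\<Sum>j<Suc n. \<Sum>k<Suc n. f ((real j - real k) * a - t))
        = (\<Sum>k<Suc n. \<Sum>j<Suc n. f (- ((real k - real j) * a + t)))"
      by (subst sum.swap) (simp add: algebra_simps)
    also have "\<dots> = of_nat (Suc n) * f (- t) + of_nat n * f (- (t - a))"
      by (rule sum_lattice_differences[where g = "\<lambda>x. f (- x)"]) (use zero t in auto)
    finally have minus: "(\<Sum>j<Suc n. \<Sum>k<Suc n. f ((real j - real k) * a - t))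
        = of_nat (Suc n) * f (- t) + of_nat n * f (a - t)" by simp
    have "(\<Sum>p\<in>A. \<Sum>q\<in>A. z p * cnj (z q) * f (x p - x q)) =
        (\<Sum>j<Suc n. \<Sum>k<Suc n. 2 * f ((real j - real k) * a)
           - f ((real j - real k) * a + t) - f ((real j - real k) * a - t))"
      unfolding A_def sum.cartesian_product' x_def z_def
      by (simp add: UNIV_bool sum.distrib sum_subtractf sum_negf algebra_simps
               sum_distrib_left del: sum.lessThan_Suc)
    also have "\<dots> = 2 * of_nat (Suc n) - (of_nat (Suc n) * f t + of_nat n * f (t - a))
        - (of_nat (Suc n) * f (- t) + of_nat n * f (a - t))"
      unfolding sum_subtractf sum_distrib_left[symmetric] diag plus minus ..
    finally have "Re (2 * of_nat (Suc n) - (of_nat (Suc n) * f t + of_nat n * f (t - a))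
        - (of_nat (Suc n) * f (- t) + of_nat n * f (a - t))) \<ge> 0"
      using positive_definite_sum_nonneg[OF pd, of A z x]
      by (simp add: A_def complex_nonneg_Reals_iff)
    then show ?thesis by (simp add: S_def R_def algebra_simps)
  qed
  have "S \<le> 0"
  proof (rule ccontr)
    assume "\<not> S \<le> 0"
    then obtain n where "R < real n * S" using reals_Archimedean3[of S] by auto
    with bound[of n] show False by simp
  qed
  then show ?thesis by (simp add: S_def)
qed

lemma integral_reflect_interval:
  fixes h :: "real \<Rightarrow> real"
  shows "integral {0..a} (\<lambda>t. h (a - t)) = integral {0..a} h"
proof -
  have "integral {0..a} (\<lambda>t. h (a - t)) = integral {-a..0} (\<lambda>t. h (a + t))"
    using Henstock_Kurzweil_Integration.integral_reflect_real[of 0 "-a" "\<lambda>t. h (a + t)"] by simp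
  also have "\<dots> = integral {0..a} h"
    using integral_shift_real_ivl[of 0 a a h] by (simp add: algebra_simps)
  finally show ?thesis .
qed

lemma lborel_integral_eq_integral_interval:
  fixes g :: "real \<Rightarrow> 'b::euclidean_space"
  assumes "continuous_on {-a..a} g" and "\<And>x. a \<le> \<bar>x\<bar> \<Longrightarrow> g x = 0"
  shows "integrable lborel g" and "(\<integral>x. g x \<partial>lborel) = integral {-a..a} g"
proof -
  have ind: "(\<lambda>x. indicator {-a..a} x *\<^sub>R g x) = g"
    using assms(2) by (force simp: indicator_def)
  have int: "set_integrable lborel {-a..a} g"
    unfolding set_integrable_def by (intro borel_integrable_compact assms(1) compact_Icc)
  then show "integrable lborel g" by (simp add: set_integrable_def ind)
  show "(\<integral>x. g x \<partial>lborel) = integral {-a..a} g"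
    using set_borel_integral_eq_integral(2)[OF int] by (simp add: set_lebesgue_integral_def ind)
qed

text \<open>
  With \<open>h t = Re (f t) + Re (f (- t))\<close>, both \<open>h\<close> and \<open>t \<mapsto> h (a - t)\<close> have integral \<open>\<integral>x. Re (f x)\<close>
  over \<open>[0, a]\<close>, and their sum is at most \<open>2\<close>.
\<close>

lemma positive_definite_integral_le:
  assumes pd: "positive_definite f" and f0: "f 0 = 1" and cont: "continuous_on UNIV f"
    and zero: "\<And>x. a \<le> \<bar>x\<bar> \<Longrightarrow> f x = 0" and a: "0 < a"
  shows "Re (\<integral>x. f x \<partial>lborel) \<le> a"
proof -
  define g where "g = (\<lambda>x. Re (f x))"
  define h where "h = (\<lambda>x. g x + g (- x))"
  have contg: "continuous_on X g" for X
    unfolding g_def by (intro continuous_intros continuous_on_subset[OF cont]) auto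
  have contgm: "continuous_on X (\<lambda>x. g (- x))" for X
    by (rule continuous_on_compose2[of UNIV g X uminus]) (auto intro!: continuous_intros contg)
  have conth: "continuous_on X h" for X
    unfolding h_def by (intro continuous_intros contg contgm)
  have conthm: "continuous_on X (\<lambda>t. h (a - t))" for X
    by (rule continuous_on_compose2[of UNIV h X "\<lambda>t. a - t"]) (auto intro!: continuous_intros conth)
  have intf: "integrable lborel f"
    by (rule lborel_integral_eq_integral_interval[where a = a])
      (use zero continuous_on_subset[OF cont] in auto)
  have "Re (\<integral>x. f x \<partial>lborel) = (\<integral>x. g x \<partial>lborel)"
    using integral_Re[OF intf] by (simp add: g_def)
  also have "\<dots> = integral {-a..a} g"
    by (rule lborel_integral_eq_integral_interval(2)[OF contg]) (simp add: g_def zero)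
  finally have I: "Re (\<integral>x. f x \<partial>lborel) = integral {-a..a} g" .
  have "integral {-a..a} g = integral {-a..0} g + integral {0..a} g"
    using a by (intro Henstock_Kurzweil_Integration.integral_combine[symmetric]
        integrable_continuous_real contg) auto
  also have "integral {-a..0} g = integral {0..a} (\<lambda>x. g (- x))"
    using Henstock_Kurzweil_Integration.integral_reflect_real[of 0 "-a" g] by simp
  also have "\<dots> + integral {0..a} g = integral {0..a} h"
    unfolding h_def
    by (subst Henstock_Kurzweil_Integration.integral_add)
      (auto intro!: integrable_continuous_real contg contgm)
  finally have Ih: "Re (\<integral>x. f x \<partial>lborel) = integral {0..a} h" using I by simp
  have pointwise: "h t + h (a - t) \<le> 2" if "t \<in> {0..a}" for t
  proof (cases "t = 0 \<or> t = a")
    case False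
    with that have "0 < t" "t < a" by auto
    from positive_definite_periodization_le[OF pd f0 zero this] show ?thesis
      by (simp add: h_def g_def)
  qed (use a in \<open>auto simp: h_def g_def zero f0\<close>)
  have "2 * integral {0..a} h = integral {0..a} h + integral {0..a} (\<lambda>t. h (a - t))"
    by (simp add: integral_reflect_interval)
  also have "\<dots> = integral {0..a} (\<lambda>t. h t + h (a - t))"
    by (intro Henstock_Kurzweil_Integration.integral_add[symmetric]
        integrable_continuous_real conth conthm)
  also have "\<dots> \<le> integral {0..a} (\<lambda>t. 2)"
    by (intro integral_le integrable_continuous_real continuous_intros conth conthm pointwise)
  also have "\<dots> = 2 * a" using a by simp
  finally show ?thesis using Ih by simp
qed

section \<open>The lower bound\<close>

definition triangle :: "real \<Rightarrow> real \<Rightarrow> real" where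
  "triangle b x = max 0 (1 - \<bar>x\<bar> / b)"

lemma triangle_eq_overlap:
  assumes "0 < b"
  shows "(\<integral>t. indicat_real {x..x + b} t * indicat_real {y..y + b} t \<partial>lborel)
         = b * triangle b (x - y)"
proof -
  have "(\<lambda>t. indicat_real {x..x + b} t * indicat_real {y..y + b} t)
        = indicat_real {max x y..min x y + b}"
    by (auto simp: fun_eq_iff indicator_def)
  then have "(\<integral>t. indicat_real {x..x + b} t * indicat_real {y..y + b} t \<partial>lborel)
        = measure lborel {max x y..min x y + b}" by simp
  also have "\<dots> = b * triangle b (x - y)"
    using assms by (auto simp: triangle_def field_simps max_def min_def abs_if)
  finally show ?thesis .
qed

text \<open>
  Since the triangle is the overlap length of two translates of an interval, the quadratic form is
  the integral of \<open>\<bar>\<Sum>j. z j * indicator {x j..x j + b}\<bar>\<^sup>2\<close>.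
\<close>

lemma positive_definite_triangle:
  assumes b: "0 < b"
  shows "positive_definite (\<lambda>x. complex_of_real (triangle b x))"
  unfolding positive_definite_def
proof (intro allI)
  fix m :: nat and x :: "nat \<Rightarrow> real" and z :: "nat \<Rightarrow> complex"
  define u where "u = (\<lambda>j. indicat_real {x j..x j + b})"
  define Q where "Q = (\<Sum>j<m. \<Sum>k<m. z j * cnj (z k) * complex_of_real (triangle b (x j - x k)))"
  have uint: "integrable lborel (\<lambda>t. u j t * u k t)" for j k
  proof -
    have "(\<lambda>t. u j t * u k t) = indicat_real ({x j..x j + b} \<inter> {x k..x k + b})"
      by (auto simp: u_def fun_eq_iff indicator_def)
    then show ?thesis by (simp add: emeasure_lborel_Icc_eq)
  qed
  have term_int: "integrable lborel (\<lambda>t. z j * cnj (z k) * complex_of_real (u j t * u k t))" for j k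
    using uint[of j k] by (intro integrable_mult_right integrable_of_real) auto
  have "complex_of_real b * Q
      = (\<Sum>j<m. \<Sum>k<m. z j * cnj (z k) * complex_of_real (\<integral>t. u j t * u k t \<partial>lborel))"
    unfolding Q_def u_def triangle_eq_overlap[OF b] by (simp add: sum_distrib_left algebra_simps)
  also have "\<dots> = (\<Sum>j<m. \<Sum>k<m. (\<integral>t. z j * cnj (z k) * complex_of_real (u j t * u k t) \<partial>lborel))"
    by (simp add: integral_of_real[symmetric] del: integral_of_real of_real_mult)
  also have "\<dots> = (\<integral>t. (\<Sum>j<m. \<Sum>k<m. z j * cnj (z k) * complex_of_real (u j t * u k t)) \<partial>lborel)"
    by (simp add: Bochner_Integration.integral_sum term_int del: of_real_mult)
  also have "\<dots> = (\<integral>t. complex_of_real ((cmod (\<Sum>j<m. z j * of_real (u j t)))\<^sup>2) \<partial>lborel)"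
    by (intro Bochner_Integration.integral_cong refl)
      (simp add: complex_norm_square sum_product mult_ac del: of_real_power)
  also have "\<dots> = complex_of_real (\<integral>t. (cmod (\<Sum>j<m. z j * of_real (u j t)))\<^sup>2 \<partial>lborel)"
    by (rule integral_complex_of_real)
  finally have "Q = complex_of_real ((\<integral>t. (cmod (\<Sum>j<m. z j * of_real (u j t)))\<^sup>2 \<partial>lborel) / b)"
    using b by (simp add: field_simps)
  then show "Q \<in> \<real>\<^sub>\<ge>\<^sub>0"
    using b by simp
qed

lemma continuous_on_triangle: "continuous_on X (triangle b)"
  unfolding triangle_def divide_inverse by (intro continuous_intros)

lemma triangle_eq_0: "0 < b \<Longrightarrow> b \<le> \<bar>x\<bar> \<Longrightarrow> triangle b x = 0"
  by (simp add: triangle_def)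

lemma integral_triangle:
  assumes b: "0 < b"
  shows "(\<integral>x. triangle b x \<partial>lborel) = b"
proof -
  have half: "integral {0..b} (triangle b) = b / 2"
  proof -
    have "((\<lambda>x. 1 - x / b) has_integral (b - b\<^sup>2 / (2 * b)) - (0 - 0\<^sup>2 / (2 * b))) {0..b}"
      using b by (intro fundamental_theorem_of_calculus)
        (auto intro!: derivative_eq_intros
              simp: has_real_derivative_iff_has_vector_derivative[symmetric])
    then have "integral {0..b} (\<lambda>x. 1 - x / b) = b / 2"
      using b by (simp add: integral_unique power2_eq_square)
    moreover have "integral {0..b} (triangle b) = integral {0..b} (\<lambda>x. 1 - x / b)"
      using b by (intro Henstock_Kurzweil_Integration.integral_cong)
        (auto simp: triangle_def max_def field_simps)
    ultimately show ?thesis by simp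
  qed
  have even: "triangle b (- x) = triangle b x" for x by (simp add: triangle_def)
  have "(\<integral>x. triangle b x \<partial>lborel) = integral {-b..b} (triangle b)"
    by (intro lborel_integral_eq_integral_interval(2) continuous_on_triangle triangle_eq_0 b)
  also have "\<dots> = integral {-b..0} (triangle b) + integral {0..b} (triangle b)"
    using b by (intro Henstock_Kurzweil_Integration.integral_combine[symmetric]
        integrable_continuous_real continuous_on_triangle) auto
  also have "integral {-b..0} (triangle b) = integral {0..b} (triangle b)"
    using Henstock_Kurzweil_Integration.integral_reflect_real[of 0 "-b" "triangle b"] by (simp add: even)
  finally show ?thesis using half by simp
qed

lemma turan_admissible_triangle:
  assumes b: "0 < b" and "{-b..b} \<subseteq> \<Omega>"
  shows "turan_admissible \<Omega> (\<lambda>x. complex_of_real (triangle b x))"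
proof -
  have "{x. complex_of_real (triangle b x) \<noteq> 0} \<subseteq> {-b..b}"
    using triangle_eq_0[OF b] by (force simp: abs_le_iff)
  then have "closed_support (\<lambda>x. complex_of_real (triangle b x)) \<subseteq> {-b..b}"
    unfolding closed_support_def by (rule closure_minimal) simp
  then show ?thesis
    using assms(2) positive_definite_triangle[OF b] continuous_on_triangle[of UNIV b]
    by (auto simp: turan_admissible_def triangle_def intro!: continuous_on_of_real)
qed

section \<open>The Turan constant of an interval\<close>

theorem turan_constant_interval:
  assumes a: "0 < a"
  shows "turan_constant {-a<..<a} = ereal a"
  unfolding turan_constant_def
proof (rule SUP_eqI)
  fix f assume "f \<in> {f. turan_admissible {-a<..<a} f}"
  then have f: "continuous_on UNIV f" "positive_definite f" "f 0 = 1"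
      "closure {x. f x \<noteq> 0} \<subseteq> {-a<..<a}"
    by (auto simp: turan_admissible_def closed_support_def)
  have "f x = 0" if "a \<le> \<bar>x\<bar>" for x
    using that f(4) closure_subset[of "{x. f x \<noteq> 0}"] by force
  with f a show "ereal (Re (\<integral>x. f x \<partial>lborel)) \<le> ereal a"
    by (simp add: positive_definite_integral_le)
next
  fix y assume y: "\<And>f. f \<in> {f. turan_admissible {-a<..<a} f} \<Longrightarrow>
      ereal (Re (\<integral>x. f x \<partial>lborel)) \<le> y"
  show "ereal a \<le> y"
  proof (rule ccontr)
    assume "\<not> ereal a \<le> y"
    then have "max 0 y < ereal a" using a by simp
    then obtain b where b: "max 0 y < ereal b" "ereal b < ereal a" using ereal_dense2 by blast
    then have "0 < b" "b < a" by auto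
    then have "turan_admissible {-a<..<a} (\<lambda>x. complex_of_real (triangle b x))"
      by (intro turan_admissible_triangle) auto
    from y[simplified, OF this] have "ereal b \<le> y"
      using \<open>0 < b\<close> by (simp add: integral_triangle)
    with b show False by auto
  qed
qed

theorem theorem1p1:
  fixes l :: real
  assumes "0 \<le> l" and "l < 2"
  shows "turan_constant (Omega l) = ereal (1 + l)"
proof -
  have "Omega l = {- (1 + l)<..<1 + l}"
    using assms by (auto simp: Omega_def)
  with assms show ?thesis by (simp add: turan_constant_interval del: minus_add_distrib)
qed

end
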